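(* Let $A$ and $D$ be symmetric and semi-positive definite $N\times N$ matrices with constant elements, let $p\geqslant 1$ be an integer, and let $C_p$ and $e_1,\dots,e_p$ be as in the context. Assume that the system $$U''+\mathcal LU+AU+D\mathcal GU'=0$$ is uniformly synchronizable by $p$-groups in $(V\times H)^N$. Let $U$ be the solution with any given initial data $(U_0,U_1)\in(V\times H)^N$. Then there exist some functions $u_1,\dots,u_p$ in $C^0(\mathbb R^+,V)\cap C^1(\mathbb R^+,H)$ and some positive constants $M\geqslant1$ and $\omega>0$ such that, setting $$u=\sum_{r=1}^p u_r\,\frac{e_r}{\|e_r\|},$$ we have for all $t\geqslant0$ $$\|(U(t)-u(t),U'(t)-u'(t))\|_{(V\times H)^N}\leqslant Me^{-\omega t}\|C_p(U_0,U_1)\|_{(V\times H)^{N-p}}.$$ Assume furthermore that $A$ satisfies the condition of $C_p$-compatibility $A\operatorname{Ker}(C_p)\subseteq\operatorname{Ker}(C_p)$ and that $D$ satisfies the condition of strong $C_p$-compatibility $\operatorname{Ker}(C_p)\subseteq\operatorname{Ker}(D)$. Then $u$ obeys a conservative system.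
   Context: $H$ and $V$ are two separated Hilbert spaces such that $V\subset H\subset V'$, $V'$ being the dual of $V$, with dense and compact imbeddings. $L$ is the duality mapping from $V$ onto $V'$, and $g$ is a linear continuous symmetric operator from $V$ into $V'$. With $I$ the identity of $\mathbb R^N$, $\mathcal L=LI$ and $\mathcal G=gI$ are the diagonal operators acting componentwise; matrices act on the $\mathbb R^N$-index, and $C_p(U,U')=(C_pU,C_pU')$. It is taken as known that the system generates a semigroup of contractions in $(V\times H)^N$; the solution with initial data $(U_0,U_1)\in(V\times H)^N$ is the corresponding weak solution $U\in C^0(\mathbb R^+,V^N)\cap C^1(\mathbb R^+,H^N)$. $\|\cdot\|$, applied to vectors of $\mathbb R^N$, is the Euclidean norm. "Conservative" is used in the usual sense (an undamped system whose energy is conserved). Groups: integers $0=n_0<n_1<\dots<n_p=N$ with $n_r-n_{r-1}\geqslant 2$ for $1\leqslant r\leqslant p$ are given, and the components of $U=(u^{(1)},\dots,u^{(N)})^T$ are arranged in the $p$ groups $(u^{(n_{r-1}+1)},\dots,u^{(n_r)})$, $1\leqslant r\leqslant p$. $S_r$ is the $(n_r-n_{r-1}-1)\times(n_r-n_{r-1})$ matrix whose $i$-th row has $1$ in column $i$, $-1$ in column $i+1$, and $0$ elsewhere; $C_p$ is the block diagonal $(N-p)\times N$ matrix with diagonal blocks $S_1,\dots,S_p$. With $\epsilon_1,\dots,\epsilon_N$ the canonical basis of $\mathbb R^N$, $e_r=\sum_{i=n_{r-1}+1}^{n_r}\epsilon_i$, so that $\operatorname{Ker}(C_p)=\operatorname{Span}\{e_1,\dots,e_p\}$.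 Uniform (exponential) synchronizability by $p$-groups: there exist constants $M\geqslant 1$ and $\omega>0$ such that for any given initial data $(U_0,U_1)\in(V\times H)^N$, where $U_0=(u_0^{(1)},\dots,u_0^{(N)})^T$ and $U_1=(u_1^{(1)},\dots,u_1^{(N)})^T$, the corresponding solution $U$ satisfies $$\|(u^{(k)}(t)-u^{(l)}(t),{u^{(k)}}'(t)-{u^{(l)}}'(t))\|_{V\times H}\leqslant Me^{-\omega t}\|(u_0^{(k)}-u_0^{(l)},u_1^{(k)}-u_1^{(l)})\|_{V\times H},\quad t\geqslant 0,$$ for all $k,l$ with $n_{r-1}+1\leqslant k,l\leqslant n_r$ and all $r$ with $1\leqslant r\leqslant p$. *)

theory Defs
  imports
    "HOL-Analysis.Analysis"
    "HOL-Library.Product_Plus"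
    "Jordan_Normal_Form.Matrix_Kernel"
begin

unbundle no vec_syntax
hide_const (open) Finite_Cartesian_Product.vec Finite_Cartesian_Product.mat
hide_type (open) Finite_Cartesian_Product.vec

subsection \<open>The Hilbert spaces\<close>

text \<open>
  The inclusion of \<open>V\<close> in \<open>H\<close> is a map \<open>i :: 'v \<Rightarrow> 'h\<close>, and \<open>V'\<close> is the type \<open>'v \<Rightarrow>\<^sub>L real\<close>.
  \<open>H\<close> is identified with its own dual, so that \<open>h\<close> acts on \<open>V\<close> by \<open>v \<mapsto> h \<bullet> i v\<close>.
  No separability is required: the compactness and density of the embeddings imply it.
\<close>

definition dense_compact_embedding ::
    "('a::real_normed_vector \<Rightarrow> 'b::real_normed_vector) \<Rightarrow> bool" where
  "dense_compact_embedding f \<longleftrightarrow>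
     bounded_linear f \<and> inj f \<and> closure (range f) = UNIV \<and>
     (\<forall>B. bounded B \<longrightarrow> compact (closure (f ` B)))"

definition to_dual :: "('v::real_inner \<Rightarrow> 'h::real_inner) \<Rightarrow> 'h \<Rightarrow> ('v \<Rightarrow>\<^sub>L real)" where
  "to_dual i h = Blinfun (\<lambda>v. inner h (i v))"

definition hilbert_triple :: "('v::real_inner \<Rightarrow> 'h::real_inner) \<Rightarrow> bool" where
  "hilbert_triple i \<longleftrightarrow> dense_compact_embedding i \<and> dense_compact_embedding (to_dual i)"

definition duality_map :: "'v::real_inner \<Rightarrow> ('v \<Rightarrow>\<^sub>L real)" where
  "duality_map = blinfun_inner_right"

definition symmetric_operator :: "('v::real_normed_vector \<Rightarrow> ('v \<Rightarrow>\<^sub>L real)) \<Rightarrow> bool" where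
  "symmetric_operator g \<longleftrightarrow> bounded_linear g \<and> (\<forall>u v. blinfun_apply (g u) v = blinfun_apply (g v) u)"

subsection \<open>Vectors of functions and matrices acting on the component index\<close>

text \<open>
  An element of \<open>X\<^sup>N\<close> is an element of \<open>carrier_vec N :: 'x vec set\<close>; components are numbered
  from \<open>0\<close> to \<open>N - 1\<close>. The operator \<open>map_vec f\<close> is the diagonal operator \<open>f I\<close>.
\<close>

definition mat_act :: "real mat \<Rightarrow> 'x::real_vector vec \<Rightarrow> 'x vec" where
  "mat_act M X = vec (dim_row M) (\<lambda>k. \<Sum>j<dim_col M. (M $$ (k, j)) *\<^sub>R (X $ j))"

definition mat_act_pair ::
    "real mat \<Rightarrow> 'v::real_vector vec \<times> 'h::real_vector vec \<Rightarrow> 'v vec \<times> 'h vec" where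
  "mat_act_pair M X = (mat_act M (fst X), mat_act M (snd X))"

text \<open>The norm of \<open>(V \<times> H)\<^sup>m\<close>, for any \<open>m\<close>.\<close>

definition norm_VH :: "'v::real_normed_vector vec \<times> 'h::real_normed_vector vec \<Rightarrow> real" where
  "norm_VH X = L2_set (\<lambda>k. norm (fst X $ k, snd X $ k)) {..<dim_vec (fst X)}"

definition states :: "nat \<Rightarrow> ('v vec \<times> 'h vec) set" where
  "states N = carrier_vec N \<times> carrier_vec N"

definition scale_state ::
    "real \<Rightarrow> 'v::real_vector vec \<times> 'h::real_vector vec \<Rightarrow> 'v vec \<times> 'h vec" where
  "scale_state c X = (map_vec (scaleR c) (fst X), map_vec (scaleR c) (snd X))"

definition sym_psd_mat :: "nat \<Rightarrow> real mat \<Rightarrow> bool" where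
  "sym_psd_mat N M \<longleftrightarrow>
     M \<in> carrier_mat N N \<and> M\<^sup>T = M \<and> (\<forall>x \<in> carrier_vec N. 0 \<le> x \<bullet> (M *\<^sub>v x))"

subsection \<open>The system\<close>

text \<open>\<open>u \<in> C\<^sup>0(\<real>\<^sup>+, V) \<inter> C\<^sup>1(\<real>\<^sup>+, H)\<close>, with derivative \<open>u'\<close> (one-sided at \<open>0\<close>).\<close>

definition C0V_C1H :: "('v::real_inner \<Rightarrow> 'h::real_inner) \<Rightarrow> (real \<Rightarrow> 'v) \<Rightarrow> (real \<Rightarrow> 'h) \<Rightarrow> bool" where
  "C0V_C1H i u u' \<longleftrightarrow>
     continuous_on {0..} u \<and> continuous_on {0..} u' \<and>
     (\<forall>t\<ge>0. ((\<lambda>s. i (u s)) has_vector_derivative u' t) (at t within {0..}))"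

text \<open>
  Weak solutions of \<open>U'' + \<L>U + AU + D\<G>U' = 0\<close>, \<open>U(0) = U0\<close>, \<open>U'(0) = U1\<close>. Since \<open>U'\<close> is only
  \<open>H\<close>-valued whereas \<open>g\<close> is defined on \<open>V\<close>, the damping term is understood as the time derivative
  of \<open>D\<G>U\<close>, and the equation reads \<open>(U' + D\<G>U)' = - (\<L>U + AU)\<close> in \<open>(V')\<^sup>N\<close>. Integrated in time,
  this says exactly that \<open>(U, U')\<close> is a mild solution of the first-order system \<open>system_op\<close> below,
  that is, an orbit of the semigroup generated by it.
\<close>

definition weak_solution ::
    "('v::real_inner \<Rightarrow> 'h::real_inner) \<Rightarrow> ('v \<Rightarrow> ('v \<Rightarrow>\<^sub>L real)) \<Rightarrow> nat \<Rightarrow> real mat \<Rightarrow> real mat \<Rightarrow>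
     'v vec \<Rightarrow> 'h vec \<Rightarrow> (real \<Rightarrow> 'v vec) \<Rightarrow> (real \<Rightarrow> 'h vec) \<Rightarrow> bool" where
  "weak_solution i g N A D U0 U1 U U' \<longleftrightarrow>
     (\<forall>t\<ge>0. (U t, U' t) \<in> states N) \<and> U 0 = U0 \<and> U' 0 = U1 \<and>
     (\<forall>k<N. C0V_C1H i (\<lambda>t. U t $ k) (\<lambda>t. U' t $ k)) \<and>
     (\<forall>k<N. \<forall>t\<ge>0.
        ((\<lambda>s. (map_vec (to_dual i) (U' s) + mat_act D (map_vec g (U s))) $ k)
           has_vector_derivative
         - ((map_vec duality_map (U t) + mat_act A (map_vec (\<lambda>v. to_dual i (i v)) (U t))) $ k))
        (at t within {0..}))"

definition energy ::
    "('v::real_inner \<Rightarrow> 'h::real_inner) \<Rightarrow> nat \<Rightarrow> real mat \<Rightarrow> 'v vec \<times> 'h vec \<Rightarrow> real" where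
  "energy i N A X =
     ((\<Sum>k<N. (norm (snd X $ k))\<^sup>2) + (\<Sum>k<N. (norm (fst X $ k))\<^sup>2) +
      (\<Sum>k<N. inner (mat_act A (map_vec i (fst X)) $ k) (i (fst X $ k)))) / 2"

text \<open>
  The graph of the operator \<open>(U, W) \<mapsto> (W, - \<L>U - AU - D\<G>W)\<close>, whose domain consists of the
  \<open>(U, W)\<close> with \<open>W \<in> V\<^sup>N\<close> and \<open>\<L>U + AU + D\<G>W \<in> H\<^sup>N\<close>; \<open>P\<close> is \<open>W\<close> regarded as an element of \<open>V\<^sup>N\<close>.
\<close>

definition system_op ::
    "('v::real_inner \<Rightarrow> 'h::real_inner) \<Rightarrow> ('v \<Rightarrow> ('v \<Rightarrow>\<^sub>L real)) \<Rightarrow> nat \<Rightarrow> real mat \<Rightarrow> real mat \<Rightarrow>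
     (('v vec \<times> 'h vec) \<times> ('v vec \<times> 'h vec)) set" where
  "system_op i g N A D =
     {((U, W), (P, Q)). (U, W) \<in> states N \<and> (P, Q) \<in> states N \<and> map_vec i P = W \<and>
        map_vec (to_dual i) Q =
          - (map_vec duality_map U + mat_act A (map_vec (\<lambda>v. to_dual i (i v)) U)
             + mat_act D (map_vec g P))}"

text \<open>
  Contractivity refers to the energy norm, which for \<open>A\<close> symmetric and semi-positive definite is an
  equivalent norm of \<open>(V \<times> H)\<^sup>N\<close>.
\<close>

definition generates_contraction_semigroup ::
    "('v::real_inner \<Rightarrow> 'h::real_inner) \<Rightarrow> ('v \<Rightarrow> ('v \<Rightarrow>\<^sub>L real)) \<Rightarrow> nat \<Rightarrow> real mat \<Rightarrow> real mat \<Rightarrow> bool" where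
  "generates_contraction_semigroup i g N A D \<longleftrightarrow>
     (\<exists>T :: real \<Rightarrow> 'v vec \<times> 'h vec \<Rightarrow> 'v vec \<times> 'h vec.
        (\<forall>t\<ge>0. \<forall>X \<in> states N. T t X \<in> states N) \<and>
        (\<forall>t\<ge>0. \<forall>X \<in> states N. \<forall>Y \<in> states N. T t (X + Y) = T t X + T t Y) \<and>
        (\<forall>t\<ge>0. \<forall>c. \<forall>X \<in> states N. T t (scale_state c X) = scale_state c (T t X)) \<and>
        (\<forall>X \<in> states N. T 0 X = X) \<and>
        (\<forall>s\<ge>0. \<forall>t\<ge>0. \<forall>X \<in> states N. T (s + t) X = T s (T t X)) \<and>
        (\<forall>X \<in> states N. ((\<lambda>t. norm_VH (T t X - X)) \<longlongrightarrow> 0) (at_right 0)) \<and>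
        (\<forall>t\<ge>0. \<forall>X \<in> states N. sqrt (energy i N A (T t X)) \<le> sqrt (energy i N A X)) \<and>
        (\<forall>X \<in> states N. \<forall>Y \<in> states N.
           ((\<lambda>h. norm_VH (scale_state (1 / h) (T h X - X) - Y)) \<longlongrightarrow> 0) (at_right 0) \<longleftrightarrow>
           (X, Y) \<in> system_op i g N A D))"

definition energy_conserved ::
    "('v::real_inner \<Rightarrow> 'h::real_inner) \<Rightarrow> ('v \<Rightarrow> ('v \<Rightarrow>\<^sub>L real)) \<Rightarrow> nat \<Rightarrow> real mat \<Rightarrow> real mat \<Rightarrow> bool" where
  "energy_conserved i g N A D \<longleftrightarrow>
     (\<forall>U0 U1 U U'. weak_solution i g N A D U0 U1 U U' \<longrightarrow>
        (\<forall>t\<ge>0. energy i N A (U t, U' t) = energy i N A (U0, U1)))"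

text \<open>
  A conservative system is the undamped system \<open>U'' + \<L>U + AU = 0\<close> (the case \<open>D = 0\<close>, in which
  \<open>g\<close> plays no role), provided that it conserves the energy.
\<close>

definition obeys_conservative_system ::
    "('v::real_inner \<Rightarrow> 'h::real_inner) \<Rightarrow> ('v \<Rightarrow> ('v \<Rightarrow>\<^sub>L real)) \<Rightarrow> nat \<Rightarrow> real mat \<Rightarrow>
     (real \<Rightarrow> 'v vec) \<Rightarrow> (real \<Rightarrow> 'h vec) \<Rightarrow> bool" where
  "obeys_conservative_system i g N A u u' \<longleftrightarrow>
     weak_solution i g N A (0\<^sub>m N N) (u 0) (u' 0) u u' \<and> energy_conserved i g N A (0\<^sub>m N N)"

subsection \<open>Groups and the synchronization matrix\<close>

definition grouping :: "nat \<Rightarrow> nat \<Rightarrow> (nat \<Rightarrow> nat) \<Rightarrow> bool" where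
  "grouping N p n \<longleftrightarrow> n 0 = 0 \<and> n p = N \<and> (\<forall>r\<in>{1..p}. n (r - 1) + 2 \<le> n r)"

text \<open>The components \<open>n\<^sub>r\<^sub>-\<^sub>1 + 1, \<dots>, n\<^sub>r\<close>, shifted to numbering from \<open>0\<close>; here \<open>1 \<le> r \<le> p\<close>.\<close>

definition group_idx :: "(nat \<Rightarrow> nat) \<Rightarrow> nat \<Rightarrow> nat set" where
  "group_idx n r = {n (r - 1)..<n r}"

definition S_mat :: "nat \<Rightarrow> real mat" where
  "S_mat m = mat (m - 1) m (\<lambda>(i, j). if j = i then 1 else if j = i + 1 then -1 else 0)"

definition C_mat :: "nat \<Rightarrow> (nat \<Rightarrow> nat) \<Rightarrow> real mat" where
  "C_mat p n = diag_block_mat (map (\<lambda>r. S_mat (n r - n (r - 1))) [1..<Suc p])"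

definition e_vec :: "nat \<Rightarrow> (nat \<Rightarrow> nat) \<Rightarrow> nat \<Rightarrow> real vec" where
  "e_vec N n r = vec N (\<lambda>k. if k \<in> group_idx n r then 1 else 0)"

definition euclid_norm :: "real vec \<Rightarrow> real" where
  "euclid_norm x = sqrt (x \<bullet> x)"

text \<open>\<open>\<Sum>\<^sub>r w\<^sub>r e\<^sub>r / \<parallel>e\<^sub>r\<parallel>\<close> for \<open>w\<^sub>1, \<dots>, w\<^sub>p\<close> in \<open>V\<close> or \<open>H\<close>.\<close>

definition group_comb ::
    "nat \<Rightarrow> nat \<Rightarrow> (nat \<Rightarrow> nat) \<Rightarrow> (nat \<Rightarrow> 'x::real_vector) \<Rightarrow> 'x vec" where
  "group_comb N p n w = vec N (\<lambda>k. \<Sum>r=1..p. (e_vec N n r $ k / euclid_norm (e_vec N n r)) *\<^sub>R w r)"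

definition uniformly_synchronizable ::
    "('v::real_inner \<Rightarrow> 'h::real_inner) \<Rightarrow> ('v \<Rightarrow> ('v \<Rightarrow>\<^sub>L real)) \<Rightarrow> nat \<Rightarrow> real mat \<Rightarrow> real mat \<Rightarrow>
     nat \<Rightarrow> (nat \<Rightarrow> nat) \<Rightarrow> bool" where
  "uniformly_synchronizable i g N A D p n \<longleftrightarrow>
     (\<exists>M \<omega>. 1 \<le> M \<and> 0 < \<omega> \<and>
        (\<forall>U0 U1 U U'. (U0, U1) \<in> states N \<and> weak_solution i g N A D U0 U1 U U' \<longrightarrow>
           (\<forall>r\<in>{1..p}. \<forall>k\<in> group_idx n r. \<forall>l\<in> group_idx n r. \<forall>t\<ge>0.
              norm (U t $ k - U t $ l, U' t $ k - U' t $ l)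
                \<le> M * exp (- \<omega> * t) * norm (U0 $ k - U0 $ l, U1 $ k - U1 $ l))))"

end

theory Submission
  imports Defs
begin

text \<open>
  Take \<open>u = PU\<close>, where \<open>P\<close> is the orthogonal projection of \<open>\<real>\<^sup>N\<close> onto \<open>Ker C\<^sub>p\<close>, that is, the average
  over each group. Then \<open>u\<^sub>k - U\<^sub>k\<close> is an average of differences \<open>U\<^sub>l - U\<^sub>k\<close> inside one group,
  which synchronization controls by the same differences at time \<open>0\<close>, and these telescope into
  rows of \<open>C\<^sub>p\<close>. Under the compatibility conditions \<open>PA = AP\<close> and \<open>PD = 0\<close> by symmetry, so
  applying \<open>P\<close> to the equation removes the damping.

  Weak solutions of the undamped system are not regular enough to differentiate the energy, so its
  conservation is derived from two times. With \<open>a\<close> the form of \<open>\<L> + A\<close>, put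
  \<open>G(s,t) = (U(s), U'(t)) - (U'(s), U(t))\<close> and \<open>F(s,t) = (U'(s), U'(t)) + a(U(s), U(t))\<close>. Then
  \<open>\<partial>\<^sub>sG = F = -\<partial>\<^sub>tG\<close> holds already for weak solutions, so \<open>G\<close> depends on \<open>s - t\<close> only and
  \<open>F(t,t) = 2E(t)\<close> is constant.
\<close>

subsection \<open>Energy conservation without damping\<close>

text \<open>Opposite partials make \<open>G\<close> constant along each line on which
  \<open>s - t\<close> is fixed. So \<open>G (h + t) t\<close> as a function of \<open>h\<close> is
  the same for all \<open>t\<close>, and its right derivative at 0, which is \<open>F t t\<close>,
  is the same too. \<open>F\<close> is never differentiated; its continuity serves only to make
  \<open>G\<close> jointly differentiable.\<close>

lemma diagonal_constant_of_opposite_partials: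
  fixes G F :: "real \<Rightarrow> real \<Rightarrow> real"
  assumes Gs: "\<And>s t. 0 \<le> s \<Longrightarrow> 0 \<le> t \<Longrightarrow> ((\<lambda>s. G s t) has_real_derivative F s t) (at s within {0..})"
    and Gt: "\<And>s t. 0 \<le> s \<Longrightarrow> 0 \<le> t \<Longrightarrow> ((\<lambda>t. G s t) has_real_derivative - F s t) (at t within {0..})"
    and F: "continuous_on ({0..} \<times> {0..}) (\<lambda>(s, t). F s t)"
    and "0 \<le> t"
  shows "F t t = F 0 0"
proof -
  \<comment> \<open>Separate partials give a total derivative once the second one is continuous. The
    rule wants that partial as a bounded linear map, so the number \<open>- F s t\<close> is encoded
    by \<open>blinfun_scaleR_left\<close>.\<close>
  have G_deriv: "((\<lambda>(s, t). G s t) has_derivative (\<lambda>(ds, dt). F s t * ds + - F s t * dt))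
      (at (s, t) within {0..} \<times> {0..})" if "0 \<le> s" "0 \<le> t" for s t
  proof -
    have "((\<lambda>(s, t). G s t) has_derivative
        (\<lambda>(ds, dt). F s t * ds + blinfun_apply (blinfun_scaleR_left (- F s t)) dt))
        (at (s, t) within {0..} \<times> {0..})"
    proof (rule has_derivative_partialsI[where fy = "\<lambda>s t. blinfun_scaleR_left (- F s t)"])
      show "((\<lambda>s. G s t) has_derivative (*) (F s t)) (at s within {0..})"
        using Gs[OF that] by (simp add: has_field_derivative_def)
      fix x y :: real assume "x \<in> {0..}" "y \<in> {0..}"
      moreover have "blinfun_apply (blinfun_scaleR_left (- F x y)) = (*) (- F x y)"
        by (auto simp: fun_eq_iff)
      ultimately show "((\<lambda>y. G x y) has_derivative blinfun_apply (blinfun_scaleR_left (- F x y)))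
          (at y within {0..})"
        using Gt[of x y] by (simp only: has_field_derivative_def atLeast_iff)
    next
      have "continuous_on ({0..} \<times> {0..}) (\<lambda>z. blinfun_scaleR_left (- (case z of (s, t) \<Rightarrow> F s t)))"
        by (intro bounded_linear.continuous_on[OF bounded_linear_blinfun_scaleR_left]
            continuous_on_minus F)
      then show "continuous (at (s, t) within {0..} \<times> {0..})
          (\<lambda>(s, t). blinfun_scaleR_left (- F s t))"
        using that by (auto simp: continuous_on_eq_continuous_within split_beta')
    qed (use that in auto)
    then show ?thesis
      by (simp add: mult.commute split_beta')
  qed
  \<comment> \<open>Along the path \<open>(h + c, c)\<close>, which stays in the quadrant since
    \<open>h\<close> is nonnegative, the chain rule gives \<open>F - F = 0\<close>.\<close>
  have shift: "G (h + c) c = G h 0" if "0 \<le> h" "0 \<le> c" for h c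
  proof -
    have "((\<lambda>c. G (h + c) c) has_real_derivative 0) (at c within {0..})" if "c \<in> {0..}" for c
    proof -
      have "((\<lambda>c. (h + c, c)) has_derivative (\<lambda>d. (d, d))) (at c within {0..})"
        by (auto intro!: derivative_eq_intros)
      moreover have "((\<lambda>(s, t). G s t) has_derivative
          (\<lambda>(ds, dt). F (h + c) c * ds + - F (h + c) c * dt))
          (at (h + c, c) within (\<lambda>c. (h + c, c)) ` {0..})"
        using that \<open>0 \<le> h\<close> by (intro has_derivative_subset[OF G_deriv]) auto
      ultimately have "((\<lambda>(s, t). G s t) \<circ> (\<lambda>c. (h + c, c)) has_derivative
          (\<lambda>(ds, dt). F (h + c) c * ds + - F (h + c) c * dt) \<circ> (\<lambda>d. (d, d))) (at c within {0..})"
        by (rule diff_chain_within)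
      then show ?thesis
        by (simp add: has_field_derivative_def o_def flip: lambda_zero)
    qed
    then obtain C where "\<forall>c\<in>{0..}. G (h + c) c = C"
      using has_field_derivative_zero_constant[of "{0..}" "\<lambda>c. G (h + c) c"] by auto
    then show ?thesis
      using that by (metis add_0_right atLeast_iff order_refl)
  qed
  have "((\<lambda>h. G (h + t) t) has_real_derivative F t t) (at 0 within {0..})"
  proof -
    have "((\<lambda>s. G s t) has_real_derivative F t t) (at (0 + t) within (\<lambda>h. h + t) ` {0..})"
      using \<open>0 \<le> t\<close> by (simp, intro DERIV_subset[OF Gs]) auto
    moreover have "((\<lambda>h. h + t) has_real_derivative 1) (at 0 within {0..})"
      by (auto intro!: derivative_eq_intros)
    ultimately show ?thesis
      using DERIV_image_chain[of "\<lambda>s. G s t" "F t t" "\<lambda>h. h + t" 0 "{0..}" 1] by (simp add: o_def)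
  qed
  \<comment> \<open>By \<open>shift\<close> the function of \<open>h\<close> just differentiated is
    \<open>G h 0\<close>, whose right derivative at 0 is also \<open>F 0 0\<close>. Uniqueness of
    the one-sided derivative equates the two values.\<close>
  then have "((\<lambda>h. G h 0) has_vector_derivative F t t) (at 0 within {0..})"
    unfolding has_real_derivative_iff_has_vector_derivative
    by (rule has_vector_derivative_transform[rotated 2]) (use shift \<open>0 \<le> t\<close> in auto)
  moreover have "((\<lambda>h. G h 0) has_vector_derivative F 0 0) (at 0 within {0..})"
    using Gs[of 0 0] by (simp add: has_real_derivative_iff_has_vector_derivative)
  moreover have "at (0::real) within {0..} \<noteq> bot"
    by (simp add: at_within_Ici_at_right)
  ultimately show ?thesis
    by (rule vector_derivative_unique_within[rotated])
qed

section \<open>Weak solutions in components, and the energy identity\<close>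

lemma blinfun_apply_to_dual:
  assumes "bounded_linear i"
  shows "blinfun_apply (to_dual i h) v = inner h (i v)"
  unfolding to_dual_def
  by (subst bounded_linear_Blinfun_apply)
     (auto intro!: bounded_linear_compose[OF bounded_linear_inner_right assms])

lemma linear_to_dual:
  assumes "bounded_linear i"
  shows "linear (to_dual i)"
  by (intro linearI blinfun_eqI)
     (simp_all add: blinfun_apply_to_dual[OF assms] inner_add_left plus_blinfun.rep_eq scaleR_blinfun.rep_eq)

lemma blinfun_apply_duality_map: "blinfun_apply (duality_map u) v = inner u v"
  by (simp add: duality_map_def)

lemma dim_mat_act [simp]: "dim_vec (mat_act M X) = dim_row M"
  by (simp add: mat_act_def)

lemma mat_act_index [simp]:
  "k < dim_row M \<Longrightarrow> mat_act M X $ k = (\<Sum>j<dim_col M. (M $$ (k, j)) *\<^sub>R (X $ j))"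
  by (simp add: mat_act_def)

text \<open>Componentwise form of the equation. Entries of \<open>map_vec\<close> and of sums of
  vectors are determined only below the dimension, which \<open>states N\<close> fixes for
  nonnegative times alone. This is enough, because the derivative is taken within
  \<open>{0..}\<close>.\<close>

lemma weak_solution_iff:
  assumes "A \<in> carrier_mat N N" "D \<in> carrier_mat N N"
  shows "weak_solution i g N A D U0 U1 U U' \<longleftrightarrow>
     (\<forall>t\<ge>0. (U t, U' t) \<in> states N) \<and> U 0 = U0 \<and> U' 0 = U1 \<and>
     (\<forall>k<N. C0V_C1H i (\<lambda>t. U t $ k) (\<lambda>t. U' t $ k)) \<and>
     (\<forall>k<N. \<forall>t\<ge>0. ((\<lambda>s. to_dual i (U' s $ k) + (\<Sum>j<N. D $$ (k, j) *\<^sub>R g (U s $ j)))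
        has_vector_derivative
        - (duality_map (U t $ k) + (\<Sum>j<N. A $$ (k, j) *\<^sub>R to_dual i (i (U t $ j)))))
        (at t within {0..}))"
proof -
  have "((\<lambda>s. (map_vec (to_dual i) (U' s) + mat_act D (map_vec g (U s))) $ k)
           has_vector_derivative
         - ((map_vec duality_map (U t) + mat_act A (map_vec (\<lambda>v. to_dual i (i v)) (U t))) $ k))
        (at t within {0..}) \<longleftrightarrow>
     ((\<lambda>s. to_dual i (U' s $ k) + (\<Sum>j<N. D $$ (k, j) *\<^sub>R g (U s $ j)))
        has_vector_derivative
        - (duality_map (U t $ k) + (\<Sum>j<N. A $$ (k, j) *\<^sub>R to_dual i (i (U t $ j)))))
        (at t within {0..})"
    if st: "\<forall>t\<ge>0. (U t, U' t) \<in> states N" and k: "k < N" and t: "0 \<le> t" for k t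
  proof -
    have dim: "dim_vec (U s) = N" "dim_vec (U' s) = N" if "0 \<le> s" for s
      using st[rule_format, OF that] unfolding states_def mem_Sigma_iff
      by (blast dest: carrier_vecD)+
    have L: "(map_vec (to_dual i) (U' s) + mat_act D (map_vec g (U s))) $ k =
        to_dual i (U' s $ k) + (\<Sum>j<N. D $$ (k, j) *\<^sub>R g (U s $ j))" if "0 \<le> s" for s
      using k assms dim[OF that] by simp
    have R: "(map_vec duality_map (U t) + mat_act A (map_vec (\<lambda>v. to_dual i (i v)) (U t))) $ k =
        duality_map (U t $ k) + (\<Sum>j<N. A $$ (k, j) *\<^sub>R to_dual i (i (U t $ j)))"
      using k assms dim[OF t] by simp
    show ?thesis
      unfolding R by (rule has_vector_derivative_cong_ev) (use L t in auto)
  qed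
  then show ?thesis
    unfolding weak_solution_def by (intro iffI) (elim conjE, intro conjI allI impI; simp)+
qed

lemma sym_psd_matD:
  assumes "sym_psd_mat N A"
  shows "A \<in> carrier_mat N N" "A\<^sup>T = A" "\<And>j k. j < N \<Longrightarrow> k < N \<Longrightarrow> A $$ (j, k) = A $$ (k, j)"
proof -
  show 1: "A \<in> carrier_mat N N" and 2: "A\<^sup>T = A"
    using assms by (auto simp: sym_psd_mat_def)
  show "A $$ (j, k) = A $$ (k, j)" if "j < N" "k < N" for j k
    using 1 2 that by (metis carrier_matD index_transpose_mat(1))
qed

text \<open>Two separate times keep the regularity demands apart: in the \<open>s\<close>-derivative
  of \<open>G s t\<close> the vectors at time \<open>t\<close> are fixed, so \<open>U\<close> has to
  be differentiable only in \<open>H\<close>, and \<open>U'\<close> only in the dual of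
  \<open>V\<close>, tested against the fixed element \<open>U t $ k\<close> of
  \<open>V\<close>.\<close>

lemma energy_conserved_undamped:
  assumes i: "bounded_linear i" and A: "sym_psd_mat N A"
  shows "energy_conserved i g N A (0\<^sub>m N N)"
  unfolding energy_conserved_def
proof (intro allI impI)
  fix U0 U1 U U' and t :: real
  assume ws: "weak_solution i g N A (0\<^sub>m N N) U0 U1 U U'" and "0 \<le> t"
  note ws' = ws[unfolded weak_solution_iff[OF sym_psd_matD(1)[OF A] zero_carrier_mat]]
  have dim: "dim_vec (U s) = N" "dim_vec (U' s) = N" if "0 \<le> s" for s
    using ws' that unfolding states_def mem_Sigma_iff by (blast dest: carrier_vecD)+
  have U: "continuous_on {0..} (\<lambda>t. U t $ k)" "continuous_on {0..} (\<lambda>t. U' t $ k)"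
    "\<And>t. 0 \<le> t \<Longrightarrow> ((\<lambda>s. i (U s $ k)) has_vector_derivative U' t $ k) (at t within {0..})"
    if "k < N" for k
    using ws' that by (auto simp: C0V_C1H_def)
  \<comment> \<open>Evaluation at a fixed \<open>v\<close> is bounded linear on the dual, so it
    turns the equation there into scalar derivatives.\<close>
  have dU': "((\<lambda>s. inner (U' s $ k) (i v)) has_vector_derivative
      - (inner (U s $ k) v + (\<Sum>j<N. A $$ (k, j) * inner (i (U s $ j)) (i v)))) (at s within {0..})"
    if "k < N" "0 \<le> s" for k s v
  proof -
    have "((\<lambda>s. to_dual i (U' s $ k) + (\<Sum>j<N. (0\<^sub>m N N :: real mat) $$ (k, j) *\<^sub>R g (U s $ j)))
        has_vector_derivative
        - (duality_map (U s $ k) + (\<Sum>j<N. A $$ (k, j) *\<^sub>R to_dual i (i (U s $ j)))))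
        (at s within {0..})"
      using ws' that by blast
    moreover have "(\<Sum>j<N. (0\<^sub>m N N :: real mat) $$ (k, j) *\<^sub>R g (U s $ j)) = 0" for s
      using \<open>k < N\<close> by (intro sum.neutral) auto
    ultimately have "((\<lambda>s. to_dual i (U' s $ k)) has_vector_derivative
        - (duality_map (U s $ k) + (\<Sum>j<N. A $$ (k, j) *\<^sub>R to_dual i (i (U s $ j)))))
        (at s within {0..})"
      by (simp only: add_0_right)
    from bounded_linear.has_vector_derivative[OF blinfun.bounded_linear_left[of v] this]
    show ?thesis
      by (simp add: blinfun_apply_to_dual[OF i] blinfun_apply_duality_map uminus_blinfun.rep_eq
          plus_blinfun.rep_eq minus_blinfun.rep_eq blinfun.sum_left scaleR_blinfun.rep_eq)
  qed
  \<comment> \<open>The symmetric form of L + A: its first term is the pairing of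
    \<open>duality_map\<close>, that is, the inner product of \<open>V\<close>.\<close>
  define q where "q s t = (\<Sum>k<N. inner (U s $ k) (U t $ k) +
    (\<Sum>j<N. A $$ (k, j) * inner (i (U s $ j)) (i (U t $ k))))" for s t
  define F where "F s t = (\<Sum>k<N. inner (U' s $ k) (U' t $ k)) + q s t" for s t
  define G where "G s t = (\<Sum>k<N. inner (i (U s $ k)) (U' t $ k) - inner (U' s $ k) (i (U t $ k)))" for s t
  have "q s t = q t s" for s t
  proof -
    have "(\<Sum>k<N. \<Sum>j<N. A $$ (k, j) * inner (i (U s $ j)) (i (U t $ k))) =
        (\<Sum>k<N. \<Sum>j<N. A $$ (j, k) * inner (i (U s $ k)) (i (U t $ j)))"
      by (rule sum.swap)
    also have "\<dots> = (\<Sum>k<N. \<Sum>j<N. A $$ (k, j) * inner (i (U t $ j)) (i (U s $ k)))"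
      using sym_psd_matD(3)[OF A] by (intro sum.cong refl) (simp add: inner_commute)
    finally show ?thesis
      by (simp add: q_def sum.distrib inner_commute)
  qed
  then have F_sym: "F s t = F t s" for s t
    by (simp add: F_def inner_commute)
  have G_antisym: "G s t = - G t s" for s t
    by (simp add: G_def inner_commute flip: sum_negf)
  have Gs: "((\<lambda>s. G s t) has_real_derivative F s t) (at s within {0..})" if "0 \<le> s" "0 \<le> t" for s t
  proof -
    have "((\<lambda>s. G s t) has_vector_derivative (\<Sum>k<N. inner (U' s $ k) (U' t $ k) -
        - (inner (U s $ k) (U t $ k) + (\<Sum>j<N. A $$ (k, j) * inner (i (U s $ j)) (i (U t $ k))))))
        (at s within {0..})"
      unfolding G_def
      by (intro has_vector_derivative_sum has_vector_derivative_diff dU' that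
          bounded_linear.has_vector_derivative[OF bounded_linear_inner_left] U(3)) auto
    also have "(\<Sum>k<N. inner (U' s $ k) (U' t $ k) -
        - (inner (U s $ k) (U t $ k) + (\<Sum>j<N. A $$ (k, j) * inner (i (U s $ j)) (i (U t $ k))))) = F s t"
      by (simp add: F_def q_def sum.distrib sum_subtractf sum_negf)
    finally show ?thesis
      by (simp add: has_real_derivative_iff_has_vector_derivative)
  qed
  \<comment> \<open>Exchanging the two times changes the sign of \<open>G\<close> and preserves
    \<open>F\<close>, by symmetry of \<open>A\<close>. The \<open>t\<close>-derivative is therefore
    the \<open>s\<close>-derivative with its sign reversed.\<close>
  have Gt: "((\<lambda>t. G s t) has_real_derivative - F s t) (at t within {0..})" if "0 \<le> s" "0 \<le> t" for s t
    unfolding G_antisym[of s] F_sym[of s] by (intro DERIV_minus Gs that)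
  have "continuous_on ({0..} \<times> {0..}) (\<lambda>(s, t). F s t)"
  proof -
    have iU: "continuous_on {0..} (\<lambda>t. i (U t $ k))" if "k < N" for k
      by (intro bounded_linear.continuous_on[OF i] U that)
    have "continuous_on ({0..} \<times> {0..}) (\<lambda>z. U (fst z) $ k)"
      "continuous_on ({0..} \<times> {0..}) (\<lambda>z. U (snd z) $ k)"
      "continuous_on ({0..} \<times> {0..}) (\<lambda>z. U' (fst z) $ k)"
      "continuous_on ({0..} \<times> {0..}) (\<lambda>z. U' (snd z) $ k)"
      "continuous_on ({0..} \<times> {0..}) (\<lambda>z. i (U (fst z) $ k))"
      "continuous_on ({0..} \<times> {0..}) (\<lambda>z. i (U (snd z) $ k))" if "k < N" for k
      by (auto intro!: continuous_intros that continuous_on_compose2[OF U(1)]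
          continuous_on_compose2[OF U(2)] continuous_on_compose2[OF iU])
    then show ?thesis
      unfolding F_def q_def split_beta' by (intro continuous_intros) auto
  qed
  with Gs Gt \<open>0 \<le> t\<close> have "F t t = F 0 0"
    by (intro diagonal_constant_of_opposite_partials[where G = G]) auto
  moreover have energy: "energy i N A (U t, U' t) = F t t / 2" if "0 \<le> t" for t
    using sym_psd_matD(1)[OF A] dim[OF that]
    by (simp add: energy_def F_def q_def power2_norm_eq_inner sum.distrib inner_sum_left)
  moreover have "U 0 = U0" "U' 0 = U1"
    using ws' by auto
  ultimately show "energy i N A (U t, U' t) = energy i N A (U0, U1)"
    using energy[OF \<open>0 \<le> t\<close>] energy[of 0] by simp
qed

section \<open>Applying a matrix to a weak solution\<close>

lemma C0V_C1H_sum: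
  assumes "bounded_linear i" and "\<And>l. l \<in> S \<Longrightarrow> C0V_C1H i (u l) (u' l)"
  shows "C0V_C1H i (\<lambda>t. \<Sum>l\<in>S. c l *\<^sub>R u l t) (\<lambda>t. \<Sum>l\<in>S. c l *\<^sub>R u' l t)"
proof -
  interpret bounded_linear i by fact
  show ?thesis
    using assms(2) unfolding C0V_C1H_def sum scaleR
    by (auto intro!: continuous_intros has_vector_derivative_sum
        bounded_linear.has_vector_derivative[OF bounded_linear_scaleR_right])
qed

text \<open>Take linear combinations of the equations with the rows of \<open>P\<close> as weights.
  The diagonal operators commute with \<open>P\<close>, \<open>PA\<close> moves \<open>P\<close>
  past the coupling, and \<open>PD\<close> cancels the damping. Damping stands under the time
  derivative as D applied to gU, so its cancellation never evaluates \<open>g\<close> at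
  \<open>U'\<close>.\<close>

lemma weak_solution_mat_act:
  assumes i: "bounded_linear i"
    and A: "A \<in> carrier_mat N N" and D: "D \<in> carrier_mat N N" and P: "P \<in> carrier_mat N N"
    and PA: "P * A = A * P" and PD: "P * D = 0\<^sub>m N N"
    and ws: "weak_solution i g N A D U0 U1 U U'"
  shows "weak_solution i g N A (0\<^sub>m N N) (mat_act P U0) (mat_act P U1)
    (\<lambda>t. mat_act P (U t)) (\<lambda>t. mat_act P (U' t))"
proof -
  note ws' = ws[unfolded weak_solution_iff[OF A D]]
  interpret i: bounded_linear i by fact
  interpret to_dual: linear "to_dual i" by (rule linear_to_dual[OF i])
  interpret duality: linear "duality_map :: 'a \<Rightarrow> _"
    unfolding duality_map_def using bounded_linear_blinfun_inner_right bounded_linear.linear by blast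
  have PA': "(\<Sum>l<N. P $$ (k, l) * A $$ (l, j)) = (\<Sum>l<N. A $$ (k, l) * P $$ (l, j))"
    if "k < N" "j < N" for k j
    using arg_cong[OF PA, of "\<lambda>M. M $$ (k, j)"] that A P
    by (simp add: scalar_prod_def lessThan_atLeast0)
  have PD': "(\<Sum>l<N. P $$ (k, l) * D $$ (l, j)) = 0" if "k < N" "j < N" for k j
    using arg_cong[OF PD, of "\<lambda>M. M $$ (k, j)"] that D P
    by (simp add: scalar_prod_def lessThan_atLeast0)
  have [simp]: "dim_row P = N" "dim_col P = N"
    using P by auto
  have "((\<lambda>s. to_dual i (mat_act P (U' s) $ k) + (\<Sum>j<N. 0\<^sub>m N N $$ (k, j) *\<^sub>R g (mat_act P (U s) $ j)))
        has_vector_derivative - (duality_map (mat_act P (U t) $ k) +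
          (\<Sum>j<N. A $$ (k, j) *\<^sub>R to_dual i (i (mat_act P (U t) $ j))))) (at t within {0..})"
    if k: "k < N" and "0 \<le> t" for k t
  proof -
    have "((\<lambda>s. \<Sum>l<N. P $$ (k, l) *\<^sub>R (to_dual i (U' s $ l) + (\<Sum>j<N. D $$ (l, j) *\<^sub>R g (U s $ j))))
        has_vector_derivative
        (\<Sum>l<N. P $$ (k, l) *\<^sub>R - (duality_map (U t $ l) +
          (\<Sum>j<N. A $$ (l, j) *\<^sub>R to_dual i (i (U t $ j)))))) (at t within {0..})"
      using ws' \<open>0 \<le> t\<close>
      by (intro has_vector_derivative_sum
          bounded_linear.has_vector_derivative[OF bounded_linear_scaleR_right]) auto
    moreover have "(\<Sum>l<N. P $$ (k, l) *\<^sub>R (to_dual i (U' s $ l) + (\<Sum>j<N. D $$ (l, j) *\<^sub>R g (U s $ j)))) =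
        to_dual i (mat_act P (U' s) $ k) + (\<Sum>j<N. 0\<^sub>m N N $$ (k, j) *\<^sub>R g (mat_act P (U s) $ j))" for s
    proof -
      have "(\<Sum>l<N. P $$ (k, l) *\<^sub>R (\<Sum>j<N. D $$ (l, j) *\<^sub>R g (U s $ j))) =
          (\<Sum>j<N. (\<Sum>l<N. P $$ (k, l) * D $$ (l, j)) *\<^sub>R g (U s $ j))"
        unfolding scaleR_sum_right scaleR_sum_left scaleR_scaleR by (rule sum.swap)
      also have "\<dots> = 0"
        using PD' k by (intro sum.neutral) auto
      finally show ?thesis
        using k by (simp add: scaleR_add_right sum.distrib to_dual.sum to_dual.scale)
    qed
    moreover have "(\<Sum>l<N. P $$ (k, l) *\<^sub>R - (duality_map (U t $ l) +
          (\<Sum>j<N. A $$ (l, j) *\<^sub>R to_dual i (i (U t $ j))))) =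
        - (duality_map (mat_act P (U t) $ k) +
          (\<Sum>j<N. A $$ (k, j) *\<^sub>R to_dual i (i (mat_act P (U t) $ j))))"
    proof -
      have "(\<Sum>l<N. P $$ (k, l) *\<^sub>R (\<Sum>j<N. A $$ (l, j) *\<^sub>R to_dual i (i (U t $ j)))) =
          (\<Sum>j<N. (\<Sum>l<N. P $$ (k, l) * A $$ (l, j)) *\<^sub>R to_dual i (i (U t $ j)))"
        unfolding scaleR_sum_right scaleR_sum_left scaleR_scaleR by (rule sum.swap)
      also have "\<dots> = (\<Sum>j<N. (\<Sum>l<N. A $$ (k, l) * P $$ (l, j)) *\<^sub>R to_dual i (i (U t $ j)))"
        using PA' k by (intro sum.cong) auto
      also have "\<dots> = (\<Sum>l<N. A $$ (k, l) *\<^sub>R (\<Sum>j<N. P $$ (l, j) *\<^sub>R to_dual i (i (U t $ j))))"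
        unfolding scaleR_sum_right scaleR_sum_left scaleR_scaleR by (rule sum.swap)
      finally show ?thesis
        using k by (simp add: scaleR_diff_right sum_negf sum_subtractf to_dual.sum to_dual.scale i.sum i.scale
            duality.sum duality.scale)
    qed
    ultimately show ?thesis
      by simp
  qed
  moreover have "C0V_C1H i (\<lambda>t. mat_act P (U t) $ k) (\<lambda>t. mat_act P (U' t) $ k)" if "k < N" for k
  proof -
    have "C0V_C1H i (\<lambda>t. \<Sum>l\<in>{..<N}. P $$ (k, l) *\<^sub>R U t $ l) (\<lambda>t. \<Sum>l\<in>{..<N}. P $$ (k, l) *\<^sub>R U' t $ l)"
      by (rule C0V_C1H_sum[OF i]) (use ws' in auto)
    then show ?thesis
      using that by simp
  qed
  moreover have "(mat_act P X, mat_act P Y) \<in> states N" for X :: "'a vec" and Y :: "'b vec"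
    unfolding states_def mem_Sigma_iff by (intro conjI carrier_vecI) simp_all
  ultimately show ?thesis
    using ws' unfolding weak_solution_iff[OF A zero_carrier_mat] by blast
qed

subsection \<open>The kernel of the synchronization matrix\<close>

text \<open>Inductions on \<open>p\<close> cannot keep the condition \<open>n p = N\<close>; these
  two consequences of \<open>grouping\<close> survive when \<open>p\<close> is lowered.\<close>

lemma grouping_step:
  assumes "grouping N p n"
  shows "n 0 = 0" "\<And>r. r \<in> {1..p} \<Longrightarrow> n (r - 1) \<le> n r"
  using assms unfolding grouping_def by (blast, meson add_leD1)

lemma grouping_mono:
  assumes "grouping N p n" "r \<le> s" "s \<le> p"
  shows "n r \<le> n s"
  using assms(2,3)
proof (induction s rule: dec_induct)
  case (step s)
  then show ?case
    using assms(1) by (auto simp: grouping_def dest!: bspec[where x = "Suc s"])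
qed simp

lemma group_idx_subset:
  assumes "grouping N p n" "r \<in> {1..p}"
  shows "group_idx n r \<subseteq> {..<N}"
  using grouping_mono[OF assms(1), of r p] assms by (auto simp: group_idx_def grouping_def)

lemma ex_group_idx:
  assumes "grouping N p n" "k < N"
  obtains r where "r \<in> {1..p}" "k \<in> group_idx n r"
proof -
  have "\<exists>r\<in>{1..q}. k \<in> group_idx n r" if "k < n q" for q
    using that
  proof (induction q)
    case 0
    then show ?case
      using assms by (simp add: grouping_def)
  next
    case (Suc q)
    then show ?case
      by (cases "k < n q") (force simp: group_idx_def)+
  qed
  from this[of p] show ?thesis
    using assms that unfolding grouping_def by blast
qed

lemma group_idx_unique:
  assumes g: "grouping N p n" and "r \<in> {1..p}" "s \<in> {1..p}" "k \<in> group_idx n r" "k \<in> group_idx n s"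
  shows "r = s"
proof (rule ccontr)
  assume "r \<noteq> s"
  then consider "r \<le> s - 1" | "s \<le> r - 1"
    by linarith
  moreover have "s - 1 \<le> p" "r - 1 \<le> p"
    using assms by auto
  ultimately have "n r \<le> n (s - 1) \<or> n s \<le> n (r - 1)"
    using grouping_mono[OF g] by cases blast+
  then show False
    using assms by (auto simp: group_idx_def)
qed

lemma dim_S_mat [simp]: "dim_row (S_mat m) = m - 1" "dim_col (S_mat m) = m"
  by (simp_all add: S_mat_def)

lemma S_mat_index:
  assumes "Suc j < m" "c < m"
  shows "S_mat m $$ (j, c) = (if c = j then 1 else if c = Suc j then - 1 else 0)"
  using assms by (simp add: S_mat_def)

lemma C_mat_0: "C_mat 0 n = 0\<^sub>m 0 0"
  by (simp add: C_mat_def)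

text \<open>\<open>diag_block_mat\<close> recurses on its first block, whereas induction on
  \<open>p\<close> appends a group at the end; hence this recursion on the last block.\<close>

lemma C_mat_Suc:
  "C_mat (Suc p) n = four_block_mat (C_mat p n)
     (0\<^sub>m (dim_row (C_mat p n)) (n (Suc p) - n p))
     (0\<^sub>m (n (Suc p) - n p - 1) (dim_col (C_mat p n))) (S_mat (n (Suc p) - n p))"
  by (simp add: C_mat_def diag_block_mat_last Let_def)

lemma dim_col_C_mat:
  assumes "n 0 = 0" "\<And>r. r \<in> {1..p} \<Longrightarrow> n (r - 1) \<le> n r"
  shows "dim_col (C_mat p n) = n p"
  using assms(2)
proof (induction p)
  case (Suc p)
  then show ?case
    using Suc.prems[of "Suc p"] by (simp add: C_mat_Suc)
qed (simp add: C_mat_0 assms)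

text \<open>Hides the row numbering: in group \<open>r\<close> the row for \<open>k\<close> is
  \<open>k - (r - 1)\<close>, as each earlier group has one row fewer than columns.
  \<open>Suc k\<close> is not forced to be a column, so membership of \<open>Suc k\<close> in a
  group is always required alongside.\<close>

definition difference_row :: "real mat \<Rightarrow> nat \<Rightarrow> nat \<Rightarrow> bool" where
  "difference_row M j k \<longleftrightarrow> j < dim_row M \<and>
     (\<forall>c<dim_col M. M $$ (j, c) = (if c = k then 1 else if c = Suc k then - 1 else 0))"

text \<open>Both directions are needed: that every row is a difference inside a group puts
  group-constant vectors into the kernel, and that every adjacent pair has a row lets differences
  telescope.\<close>

lemma C_mat_difference_rows:
  assumes "n 0 = 0" "\<And>r. r \<in> {1..p} \<Longrightarrow> n (r - 1) \<le> n r"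
  shows "(\<forall>j<dim_row (C_mat p n). \<exists>r\<in>{1..p}. \<exists>k. k \<in> group_idx n r \<and> Suc k \<in> group_idx n r \<and>
           difference_row (C_mat p n) j k) \<and>
    (\<forall>r\<in>{1..p}. \<forall>k. k \<in> group_idx n r \<and> Suc k \<in> group_idx n r \<longrightarrow>
      (\<exists>j. difference_row (C_mat p n) j k))"
  using assms(2)
proof (induction p)
  case 0
  then show ?case by (simp add: C_mat_0)
next
  case (Suc p)
  let ?m = "n (Suc p) - n p"
  have dim: "dim_col (C_mat p n) = n p"
    using Suc.prems by (intro dim_col_C_mat assms(1)) auto
  have mono: "n r \<le> n p" if "r \<le> p" for r
    using that
  proof (induction r rule: inc_induct)
    case (step r)
    then show ?case using Suc.prems[of "Suc r"] by auto
  qed simp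
  \<comment> \<open>Old rows are padded with zeros on the right. This does no harm because
    \<open>Suc k\<close> lies in an old group, so the entry -1 is in an old column.\<close>
  have old: "difference_row (C_mat (Suc p) n) j k"
    if "difference_row (C_mat p n) j k" "r \<in> {1..p}" "Suc k \<in> group_idx n r" for j k r
    using that mono[of r] dim by (auto simp: difference_row_def C_mat_Suc group_idx_def)
  have new: "difference_row (C_mat (Suc p) n) (dim_row (C_mat p n) + j) (n p + j)"
    if "Suc j < ?m" for j
    using that dim by (auto simp: difference_row_def C_mat_Suc S_mat_index)
  have IH: "\<forall>j<dim_row (C_mat p n). \<exists>r\<in>{1..p}. \<exists>k. k \<in> group_idx n r \<and> Suc k \<in> group_idx n r \<and>
           difference_row (C_mat p n) j k"
    "\<forall>r\<in>{1..p}. \<forall>k. k \<in> group_idx n r \<and> Suc k \<in> group_idx n r \<longrightarrow>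
      (\<exists>j. difference_row (C_mat p n) j k)"
    using Suc by auto
  have "\<exists>r\<in>{1..Suc p}. \<exists>k. k \<in> group_idx n r \<and> Suc k \<in> group_idx n r \<and>
           difference_row (C_mat (Suc p) n) j k" if j: "j < dim_row (C_mat (Suc p) n)" for j
  proof (cases "j < dim_row (C_mat p n)")
    case True
    then obtain r k where "r \<in> {1..p}" "k \<in> group_idx n r" "Suc k \<in> group_idx n r"
      "difference_row (C_mat p n) j k"
      using IH(1) by blast
    then show ?thesis
      using old by (intro bexI[of _ r] exI[of _ k]) auto
  next
    case False
    define j' where "j' = j - dim_row (C_mat p n)"
    have j': "j = dim_row (C_mat p n) + j'" "Suc j' < ?m"
      using False j by (auto simp: j'_def C_mat_Suc)
    then show ?thesis
      using new[OF j'(2)] by (intro bexI[of _ "Suc p"] exI[of _ "n p + j'"]) (auto simp: group_idx_def)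
  qed
  moreover have "\<exists>j. difference_row (C_mat (Suc p) n) j k"
    if "r \<in> {1..Suc p}" "k \<in> group_idx n r" "Suc k \<in> group_idx n r" for r k
  proof (cases "r = Suc p")
    case True
    then have "n p + (k - n p) = k" "Suc (k - n p) < ?m"
      using that by (auto simp: group_idx_def)
    then show ?thesis
      using new[of "k - n p"] by metis
  next
    case False
    then show ?thesis
      using IH(2) old that by (metis atLeastAtMost_iff le_SucE)
  qed
  ultimately show ?case by blast
qed

text \<open>Stated with \<open>scaleR\<close> so that it evaluates a row of \<open>C_mat\<close> on
  real vectors as well as on vectors over \<open>V\<close> and \<open>H\<close>.\<close>

lemma sum_difference:
  fixes X :: "nat \<Rightarrow> 'x::real_vector"
  assumes "Suc k < m"
  shows "(\<Sum>c<m. (if c = k then 1 else if c = Suc k then - 1 else 0) *\<^sub>R X c) = X k - X (Suc k)"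
proof -
  have "(\<Sum>c<m. (if c = k then 1 else if c = Suc k then - 1 else 0) *\<^sub>R X c) =
      (\<Sum>c<m. (if c = k then X c else 0) - (if c = Suc k then X c else 0))"
    by (intro sum.cong) auto
  then show ?thesis
    using assms by (simp add: sum_subtractf sum.delta)
qed

definition group_constant :: "nat \<Rightarrow> (nat \<Rightarrow> nat) \<Rightarrow> (nat \<Rightarrow> 'x) \<Rightarrow> bool" where
  "group_constant p n x \<longleftrightarrow> (\<forall>r\<in>{1..p}. \<forall>k\<in>group_idx n r. \<forall>l\<in>group_idx n r. x k = x l)"

text \<open>A group is an interval, so the telescoping path from \<open>k\<close> to
  \<open>l\<close> stays inside it and has at most \<open>N\<close> steps. With \<open>B = 0\<close>
  it proves equality on a group; with \<open>B\<close> the norm of the image of the data under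
  \<open>C_mat\<close> it bounds initial differences.\<close>

lemma group_idx_norm_diff_le:
  fixes Z :: "nat \<Rightarrow> 'x::real_normed_vector"
  assumes g: "grouping N p n" and r: "r \<in> {1..p}" and "k \<in> group_idx n r" "l \<in> group_idx n r"
    and step: "\<And>k. k \<in> group_idx n r \<Longrightarrow> Suc k \<in> group_idx n r \<Longrightarrow> norm (Z k - Z (Suc k)) \<le> B"
    and "0 \<le> B"
  shows "norm (Z k - Z l) \<le> N * B"
proof -
  have *: "norm (Z k - Z l) \<le> N * B" if kl: "k \<le> l" "k \<in> group_idx n r" "l \<in> group_idx n r" for k l
  proof -
    have "norm (Z k - Z l) \<le> (l - k) * B"
      using kl
    proof (induction l rule: dec_induct)
      case (step l)
      then have "l \<in> group_idx n r"
        by (auto simp: group_idx_def)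
      then have "norm (Z k - Z l) \<le> (l - k) * B" "norm (Z l - Z (Suc l)) \<le> B"
        using step assms(5) by auto
      moreover have "norm (Z k - Z (Suc l)) \<le> norm (Z k - Z l) + norm (Z l - Z (Suc l))"
        using norm_triangle_ineq[of "Z k - Z l" "Z l - Z (Suc l)"] by simp
      moreover have "real (Suc l - k) * B = (l - k) * B + B"
        using \<open>k \<le> l\<close> by (simp add: Suc_diff_le algebra_simps)
      ultimately show ?case by linarith
    qed simp
    also have "\<dots> \<le> N * B"
      using kl group_idx_subset[OF g r] \<open>0 \<le> B\<close> by (intro mult_right_mono) auto
    finally show ?thesis .
  qed
  show ?thesis
    using *[of k l] *[of l k] assms(3,4) by (cases "k \<le> l") (auto simp: norm_minus_commute)
qed

lemma C_mat_carrier: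
  assumes "grouping N p n"
  shows "C_mat p n \<in> carrier_mat (dim_row (C_mat p n)) N"
proof (rule carrier_matI)
  show "dim_col (C_mat p n) = N"
    using assms dim_col_C_mat[OF grouping_step[OF assms]] by (simp add: grouping_def)
qed simp

text \<open>Group-constant vectors are exactly the combinations of the \<open>e_vec N n r\<close>,
  so this is Ker(C_p) = Span{e_1, ..., e_p} in a form that can be checked entry by entry.\<close>

lemma mat_kernel_C_mat:
  assumes g: "grouping N p n"
  shows "mat_kernel (C_mat p n) = {x \<in> carrier_vec N. group_constant p n (($) x)}"
proof -
  let ?C = "C_mat p n"
  have dim: "dim_col ?C = N"
    using C_mat_carrier[OF g] by auto
  have rows: "(?C *\<^sub>v x) $ j = x $ k - x $ Suc k"
    if x: "x \<in> carrier_vec N" and j: "difference_row ?C j k"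
      and r: "r \<in> {1..p}" "Suc k \<in> group_idx n r" for x j k r
  proof -
    have "(?C *\<^sub>v x) $ j = (\<Sum>c<N. ?C $$ (j, c) * x $ c)"
      using x j dim by (simp add: difference_row_def scalar_prod_def lessThan_atLeast0)
    also have "\<dots> = (\<Sum>c<N. (if c = k then 1 else if c = Suc k then - 1 else 0) *\<^sub>R x $ c)"
      using j dim by (intro sum.cong) (auto simp: difference_row_def)
    also have "\<dots> = x $ k - x $ Suc k"
      using group_idx_subset[OF g r(1)] r(2) by (intro sum_difference) auto
    finally show ?thesis .
  qed
  note C = C_mat_difference_rows[OF grouping_step[OF g]]
  show ?thesis
  proof (intro equalityI subsetI)
    fix x assume "x \<in> mat_kernel ?C"
    then have x: "x \<in> carrier_vec N" "?C *\<^sub>v x = 0\<^sub>v (dim_row ?C)"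
      using dim by (auto simp: mat_kernel_def)
    have adjacent: "norm (x $ k - x $ Suc k) \<le> 0"
      if r: "r \<in> {1..p}" "k \<in> group_idx n r" "Suc k \<in> group_idx n r" for r k
    proof -
      obtain j where j: "difference_row ?C j k"
        using C r by blast
      then show ?thesis
        using rows[OF x(1) j r(1,3)] x(2) by (simp add: difference_row_def)
    qed
    have "x $ k = x $ l"
      if r: "r \<in> {1..p}" "k \<in> group_idx n r" "l \<in> group_idx n r" for r k l
    proof -
      have "norm (x $ k - x $ l) \<le> real N * 0"
        by (rule group_idx_norm_diff_le[OF g r]) (use adjacent[OF r(1)] in blast, simp)
      then show ?thesis by simp
    qed
    then show "x \<in> {x \<in> carrier_vec N. group_constant p n (($) x)}"
      using x(1) unfolding group_constant_def by blast
  next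
    fix x :: "real vec" assume "x \<in> {x \<in> carrier_vec N. group_constant p n (($) x)}"
    then have x: "x \<in> carrier_vec N" "group_constant p n (($) x)"
      by auto
    have "(?C *\<^sub>v x) $ j = 0" if j: "j < dim_row ?C" for j
    proof -
      obtain r k where r: "r \<in> {1..p}" "k \<in> group_idx n r" "Suc k \<in> group_idx n r"
        "difference_row ?C j k"
        using C j by blast
      have "x $ k = x $ Suc k"
        using x(2) r(1-3) unfolding group_constant_def by blast
      then show ?thesis
        using rows[OF x(1) r(4,1,3)] by simp
    qed
    then show "x \<in> mat_kernel ?C"
      using x(1) dim by (auto simp: mat_kernel_def intro!: eq_vecI)
  qed
qed

section \<open>Norm estimates against the data seen through \<open>C_mat\<close>\<close>

lemma norm_VH_component:
  assumes "k < dim_vec (fst X)"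
  shows "norm (fst X $ k, snd X $ k) \<le> norm_VH X"
  unfolding norm_VH_def using assms by (intro member_le_L2_set) auto

lemma norm_VH_nonneg: "0 \<le> norm_VH X"
  by (simp add: norm_VH_def)

text \<open>The Euclidean norm is at most the sum of the component norms; this costs one factor
  \<open>N\<close> in the final constant.\<close>

lemma norm_VH_le:
  assumes "dim_vec y = N" "\<And>k. k < N \<Longrightarrow> norm (x $ k - y $ k, x' $ k - y' $ k) \<le> b" "dim_vec y' = N"
  shows "norm_VH (x - y, x' - y') \<le> N * b"
proof -
  have "norm_VH (x - y, x' - y') = L2_set (\<lambda>k. norm (x $ k - y $ k, x' $ k - y' $ k)) {..<N}"
    unfolding norm_VH_def using assms(1,3) by (intro L2_set_cong) auto
  also have "\<dots> \<le> (\<Sum>k<N. norm (x $ k - y $ k, x' $ k - y' $ k))"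
    by (intro L2_set_le_sum) simp
  also have "\<dots> \<le> (\<Sum>k<N. b)"
    using assms(2) by (intro sum_mono) auto
  finally show ?thesis by simp
qed

text \<open>Each adjacent difference is a component of
  \<open>mat_act_pair (C_mat p n) (U0, U1)\<close>, hence bounded by its norm. Working with pairs
  telescopes positions and velocities together.\<close>

lemma group_idx_norm_diff_le_C_mat:
  fixes U0 :: "'v::real_normed_vector vec" and U1 :: "'h::real_normed_vector vec"
  assumes g: "grouping N p n" and r: "r \<in> {1..p}" and "k \<in> group_idx n r" "l \<in> group_idx n r"
  shows "norm ((U0 $ k, U1 $ k) - (U0 $ l, U1 $ l)) \<le> N * norm_VH (mat_act_pair (C_mat p n) (U0, U1))"
proof (rule group_idx_norm_diff_le[OF g r assms(3,4)])
  let ?C = "C_mat p n"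
  fix k assume k: "k \<in> group_idx n r" "Suc k \<in> group_idx n r"
  obtain j where j: "difference_row ?C j k"
    using C_mat_difference_rows[OF grouping_step[OF g]] r k by blast
  have dim: "dim_col ?C = N"
    using C_mat_carrier[OF g] by auto
  have row: "mat_act ?C X $ j = X $ k - X $ Suc k" for X :: "'x::real_vector vec"
  proof -
    have "mat_act ?C X $ j = (\<Sum>c<N. ?C $$ (j, c) *\<^sub>R X $ c)"
      using j dim by (simp add: difference_row_def)
    also have "\<dots> = (\<Sum>c<N. (if c = k then 1 else if c = Suc k then - 1 else 0) *\<^sub>R X $ c)"
      using j dim by (intro sum.cong) (auto simp: difference_row_def)
    also have "\<dots> = X $ k - X $ Suc k"
      using group_idx_subset[OF g r] k by (intro sum_difference) auto
    finally show ?thesis .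
  qed
  show "norm ((U0 $ k, U1 $ k) - (U0 $ Suc k, U1 $ Suc k)) \<le> norm_VH (mat_act_pair ?C (U0, U1))"
    using norm_VH_component[of j "mat_act_pair ?C (U0, U1)"] j
    by (simp add: mat_act_pair_def row difference_row_def)
qed (rule norm_VH_nonneg)

section \<open>The orthogonal projection onto Ker(C_p), as averaging over groups\<close>

definition group_projection :: "nat \<Rightarrow> nat \<Rightarrow> (nat \<Rightarrow> nat) \<Rightarrow> real mat" where
  "group_projection N p n = mat N N (\<lambda>(k, l). \<Sum>r=1..p.
     (e_vec N n r $ k / euclid_norm (e_vec N n r)) * (e_vec N n r $ l / euclid_norm (e_vec N n r)))"

lemma group_projection_carrier: "group_projection N p n \<in> carrier_mat N N"
  by (simp add: group_projection_def)

lemma dim_group_projection [simp]: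
  "dim_row (group_projection N p n) = N" "dim_col (group_projection N p n) = N"
  by (simp_all add: group_projection_def)

lemma group_projection_transpose: "(group_projection N p n)\<^sup>T = group_projection N p n"
  by (intro eq_matI) (simp_all add: group_projection_def mult.commute)

text \<open>The vectors e_r / |e_r| are orthonormal, and the projection is expanded in them. The
  coefficients will serve as the functions u_r.\<close>

lemma group_comb_coefficients:
  "group_comb N p n (\<lambda>r. \<Sum>l<N. (e_vec N n r $ l / euclid_norm (e_vec N n r)) *\<^sub>R X $ l) =
   mat_act (group_projection N p n) X"
proof (intro eq_vecI)
  fix k assume "k < dim_vec (mat_act (group_projection N p n) X)"
  then have "k < N" by simp
  then show "group_comb N p n (\<lambda>r. \<Sum>l<N. (e_vec N n r $ l / euclid_norm (e_vec N n r)) *\<^sub>R X $ l) $ k =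
      mat_act (group_projection N p n) X $ k"
    unfolding group_comb_def scaleR_sum_right
    by (subst sum.swap) (simp_all add: group_projection_def scaleR_sum_left sum.swap[of _ "{..<N}"])
qed (simp add: group_comb_def)

lemma e_vec_index: "k < N \<Longrightarrow> e_vec N n r $ k = (if k \<in> group_idx n r then 1 else 0)"
  by (simp add: e_vec_def)

lemma euclid_norm_e_vec:
  assumes "grouping N p n" "r \<in> {1..p}"
  shows "(euclid_norm (e_vec N n r))\<^sup>2 = card (group_idx n r)" "0 < card (group_idx n r)"
proof -
  have "e_vec N n r \<bullet> e_vec N n r = (\<Sum>k\<in>{..<N}. if k \<in> group_idx n r then 1 else 0)"
    by (auto simp: e_vec_def scalar_prod_def lessThan_atLeast0 intro!: sum.cong)
  also have "\<dots> = card (group_idx n r)"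
    using group_idx_subset[OF assms] by (simp add: sum.If_cases Int_absorb1)
  finally show "(euclid_norm (e_vec N n r))\<^sup>2 = card (group_idx n r)"
    by (simp add: euclid_norm_def)
  have "n (r - 1) + 2 \<le> n r"
    using assms unfolding grouping_def by blast
  then show "0 < card (group_idx n r)"
    by (simp add: group_idx_def)
qed

text \<open>Groups are disjoint, so only the summand of the group containing \<open>k\<close>
  survives; row \<open>k\<close> is the uniform average over that group.\<close>

lemma group_projection_index:
  assumes g: "grouping N p n" and r: "r \<in> {1..p}" and k: "k \<in> group_idx n r" and "l < N"
  shows "group_projection N p n $$ (k, l) = (if l \<in> group_idx n r then 1 / card (group_idx n r) else 0)"
proof -
  have "k < N"
    using group_idx_subset[OF g r] k by auto
  have mem: "k \<in> group_idx n s \<longleftrightarrow> s = r" if "s \<in> {1..p}" for s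
    using group_idx_unique[OF g r that k] k by blast
  have "group_projection N p n $$ (k, l) = (\<Sum>s=1..p.
      (e_vec N n s $ k / euclid_norm (e_vec N n s)) * (e_vec N n s $ l / euclid_norm (e_vec N n s)))"
    using \<open>k < N\<close> \<open>l < N\<close> by (simp add: group_projection_def)
  also have "\<dots> =
      (\<Sum>s=1..p. if s = r then (if l \<in> group_idx n r then 1 / (euclid_norm (e_vec N n r))\<^sup>2 else 0) else 0)"
    using mem \<open>k < N\<close> \<open>l < N\<close>
    by (intro sum.cong refl) (simp add: e_vec_index power2_eq_square)
  finally show ?thesis
    using r euclid_norm_e_vec[OF g r] by (simp add: sum.delta)
qed

text \<open>An average reproduces a value that is constant on the group. For a constant family this
  says that the weights of a row add up to one.\<close>

lemma group_projection_sum: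
  fixes x :: "nat \<Rightarrow> 'x::real_vector"
  assumes g: "grouping N p n" and r: "r \<in> {1..p}" and k: "k \<in> group_idx n r"
    and x: "\<And>l. l \<in> group_idx n r \<Longrightarrow> x l = y"
  shows "(\<Sum>l<N. group_projection N p n $$ (k, l) *\<^sub>R x l) = y"
proof -
  have "(\<Sum>l<N. group_projection N p n $$ (k, l) *\<^sub>R x l) =
      (\<Sum>l<N. if l \<in> group_idx n r then (1 / card (group_idx n r)) *\<^sub>R y else 0)"
    using group_projection_index[OF g r k] x by (intro sum.cong) auto
  also have "\<dots> = (\<Sum>l\<in>group_idx n r. (1 / card (group_idx n r)) *\<^sub>R y)"
    using group_idx_subset[OF g r] by (simp add: sum.If_cases Int_absorb1)
  also have "\<dots> = y"
    using euclid_norm_e_vec(2)[OF g r] by (simp add: sum_constant_scaleR)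
  finally show ?thesis .
qed

text \<open>The weights are nonnegative, sum to one and vanish outside the group, so the difference
  is a convex combination of the differences \<open>Z k - Z l\<close> inside the group.\<close>

lemma norm_diff_group_projection_le:
  fixes Z :: "nat \<Rightarrow> 'x::real_normed_vector"
  assumes g: "grouping N p n" and r: "r \<in> {1..p}" and k: "k \<in> group_idx n r"
    and Z: "\<And>l. l \<in> group_idx n r \<Longrightarrow> norm (Z k - Z l) \<le> b"
  shows "norm (Z k - (\<Sum>l<N. group_projection N p n $$ (k, l) *\<^sub>R Z l)) \<le> b"
proof -
  let ?P = "\<lambda>l. group_projection N p n $$ (k, l)"
  have "Z k - (\<Sum>l<N. ?P l *\<^sub>R Z l) = (\<Sum>l<N. ?P l *\<^sub>R Z k) - (\<Sum>l<N. ?P l *\<^sub>R Z l)"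
    using group_projection_sum[OF g r k, of "\<lambda>_. Z k"] by simp
  also have "\<dots> = (\<Sum>l<N. ?P l *\<^sub>R (Z k - Z l))"
    by (simp add: scaleR_diff_right sum_subtractf)
  also have "norm \<dots> \<le> (\<Sum>l<N. ?P l * b)"
    using group_projection_index[OF g r k] Z by (intro sum_norm_le) (auto intro!: divide_right_mono)
  also have "\<dots> = b"
    using group_projection_sum[OF g r k, of "\<lambda>_. b"] by simp
  finally show ?thesis .
qed

section \<open>The compatibility conditions as matrix identities\<close>

lemma col_group_projection_in_kernel:
  assumes g: "grouping N p n" and j: "j < N"
  shows "col (group_projection N p n) j \<in> mat_kernel (C_mat p n)"
  unfolding mat_kernel_C_mat[OF g] group_constant_def
proof (intro CollectI conjI ballI)
  fix r k l assume r: "r \<in> {1..p}" and k: "k \<in> group_idx n r" and l: "l \<in> group_idx n r"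
  then have "k < N" "l < N"
    using group_idx_subset[OF g r] by auto
  then show "col (group_projection N p n) j $ k = col (group_projection N p n) j $ l"
    using group_projection_index[OF g r k j] group_projection_index[OF g r l j] j by simp
qed (simp add: carrier_vecI)

text \<open>Invariance of the kernel, read column by column, says PAP = AP. As A and P are
  symmetric, so is PAP, and transposing gives PAP = PA.\<close>

lemma group_projection_commute:
  assumes g: "grouping N p n" and A: "A \<in> carrier_mat N N" "A\<^sup>T = A"
    and ker: "(\<lambda>x. A *\<^sub>v x) ` mat_kernel (C_mat p n) \<subseteq> mat_kernel (C_mat p n)"
  shows "group_projection N p n * A = A * group_projection N p n"
proof -
  let ?P = "group_projection N p n"
  note P = group_projection_carrier[of N p n]
  have "(?P * (A * ?P)) $$ (k, j) = (A * ?P) $$ (k, j)" if "k < N" "j < N" for k j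
  proof -
    obtain r where r: "r \<in> {1..p}" "k \<in> group_idx n r"
      using ex_group_idx[OF g \<open>k < N\<close>] .
    have "A *\<^sub>v col ?P j \<in> mat_kernel (C_mat p n)"
      using ker col_group_projection_in_kernel[OF g \<open>j < N\<close>] by blast
    then have "group_constant p n (\<lambda>l. (A *\<^sub>v col ?P j) $ l)"
      by (simp add: mat_kernel_C_mat[OF g])
    moreover have "(A *\<^sub>v col ?P j) $ l = (A * ?P) $$ (l, j)" if "l < N" for l
      using that \<open>j < N\<close> A by simp
    moreover have "l < N" if "l \<in> group_idx n r" for l
      using that group_idx_subset[OF g r(1)] by auto
    ultimately have "(A * ?P) $$ (l, j) = (A * ?P) $$ (k, j)" if "l \<in> group_idx n r" for l
      using that r unfolding group_constant_def by metis
    from group_projection_sum[OF g r, of "\<lambda>l. (A * ?P) $$ (l, j)", OF this]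
    show ?thesis
      using that A P by (simp add: scalar_prod_def lessThan_atLeast0 del: index_mult_mat(1))
         (simp add: scalar_prod_def lessThan_atLeast0)
  qed
  then have PAP: "?P * (A * ?P) = A * ?P"
    using A P by (intro eq_matI) auto
  have "?P * A = (A * ?P)\<^sup>T"
    using transpose_mult[OF A(1) P] A(2) by (simp add: group_projection_transpose)
  also have "\<dots> = (?P * (A * ?P))\<^sup>T"
    by (simp add: PAP)
  also have "\<dots> = (?P * A) * ?P"
    using A P by (simp add: transpose_mult[of _ N N _ N] group_projection_transpose)
  also have "\<dots> = A * ?P"
    using A P PAP by (simp add: assoc_mult_mat[of _ N N _ N _ N])
  finally show ?thesis .
qed

text \<open>The columns of P lie in the kernel of D, so DP = 0; transposing, with D and P symmetric,
  gives PD = 0.\<close>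

lemma group_projection_mult_zero:
  assumes g: "grouping N p n" and D: "D \<in> carrier_mat N N" "D\<^sup>T = D"
    and ker: "mat_kernel (C_mat p n) \<subseteq> mat_kernel D"
  shows "group_projection N p n * D = 0\<^sub>m N N"
proof -
  let ?P = "group_projection N p n"
  note P = group_projection_carrier[of N p n]
  have "(D * ?P) $$ (k, j) = 0" if "k < N" "j < N" for k j
  proof -
    have "D *\<^sub>v col ?P j = 0\<^sub>v N"
      using ker col_group_projection_in_kernel[OF g \<open>j < N\<close>] D by (auto simp: mat_kernel_def)
    then have "(D *\<^sub>v col ?P j) $ k = 0"
      using that by simp
    then show ?thesis
      using that D by simp
  qed
  then have "D * ?P = 0\<^sub>m N N"
    using D P by (intro eq_matI) auto
  then have "(D * ?P)\<^sup>T = 0\<^sub>m N N"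
    by (simp add: transpose_mat_def) (auto intro!: eq_matI)
  then show ?thesis
    using transpose_mult[OF D(1) P] D(2) by (simp add: group_projection_transpose)
qed

section \<open>The synchronized part, its exponential estimate and its equation\<close>

theorem theorem3p9:
  fixes i :: "'v::{real_inner, complete_space} \<Rightarrow> 'h::{real_inner, complete_space}"
    and g :: "'v \<Rightarrow> ('v \<Rightarrow>\<^sub>L real)"
    and N p :: nat and n :: "nat \<Rightarrow> nat" and A D :: "real mat"
  assumes "hilbert_triple i"
    and "symmetric_operator g"
    and "sym_psd_mat N A" and "sym_psd_mat N D"
    and "1 \<le> p" and "grouping N p n"
    and "generates_contraction_semigroup i g N A D"
    and "uniformly_synchronizable i g N A D p n"
  shows "\<exists>M \<omega>. 1 \<le> M \<and> 0 < \<omega> \<and>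
    (\<forall>U0 U1 U U'. (U0, U1) \<in> states N \<and> weak_solution i g N A D U0 U1 U U' \<longrightarrow>
      (\<exists>(w :: nat \<Rightarrow> real \<Rightarrow> 'v) (w' :: nat \<Rightarrow> real \<Rightarrow> 'h) u u'.
        (\<forall>r\<in>{1..p}. C0V_C1H i (w r) (w' r)) \<and>
        u = (\<lambda>t. group_comb N p n (\<lambda>r. w r t)) \<and>
        u' = (\<lambda>t. group_comb N p n (\<lambda>r. w' r t)) \<and>
        (\<forall>t\<ge>0. norm_VH (U t - u t, U' t - u' t)
                 \<le> M * exp (- \<omega> * t) * norm_VH (mat_act_pair (C_mat p n) (U0, U1))) \<and>
        ((\<lambda>x. A *\<^sub>v x) ` mat_kernel (C_mat p n) \<subseteq> mat_kernel (C_mat p n) \<and>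
         mat_kernel (C_mat p n) \<subseteq> mat_kernel D \<longrightarrow>
           obeys_conservative_system i g N A u u')))"
proof -
  let ?C = "C_mat p n" and ?P = "group_projection N p n"
  have i: "bounded_linear i"
    using assms(1) by (simp add: hilbert_triple_def dense_compact_embedding_def)
  have A: "A \<in> carrier_mat N N" "A\<^sup>T = A" and D: "D \<in> carrier_mat N N" "D\<^sup>T = D"
    using sym_psd_matD assms(3,4) by blast+
  note g = \<open>grouping N p n\<close>
  obtain M \<omega> where "1 \<le> M" "0 < \<omega>" and sync:
    "\<And>U0 U1 U U' r k l t. (U0, U1) \<in> states N \<Longrightarrow> weak_solution i g N A D U0 U1 U U' \<Longrightarrow>
      r \<in> {1..p} \<Longrightarrow> k \<in> group_idx n r \<Longrightarrow> l \<in> group_idx n r \<Longrightarrow> 0 \<le> t \<Longrightarrow>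
      norm (U t $ k - U t $ l, U' t $ k - U' t $ l)
        \<le> M * exp (- \<omega> * t) * norm (U0 $ k - U0 $ l, U1 $ k - U1 $ l)"
    using assms(8) unfolding uniformly_synchronizable_def by blast
  \<comment> \<open>Since \<open>p\<close> is at least 1, there is a first group, and it has at
    least two components.\<close>
  have "1 \<le> N"
    using g grouping_mono[OF g, of 1 p] \<open>1 \<le> p\<close> by (force simp: grouping_def)
  have M: "1 \<le> real N * real N * M"
    using \<open>1 \<le> N\<close> \<open>1 \<le> M\<close> mult_mono[of 1 "real N * real N" 1 M] mult_mono[of 1 "real N" 1 "real N"] by simp
  show ?thesis
  \<comment> \<open>One factor \<open>N\<close> pays for telescoping the initial differences, the
    other for passing from components to \<open>norm_VH\<close>. The rate is that of
    synchronization, and both constants are chosen before the data.\<close>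
  proof (intro exI[of _ "real N * real N * M"] exI[of _ \<omega>] conjI M \<open>0 < \<omega>\<close> allI impI, elim conjE)
    fix U0 :: "'v vec" and U1 :: "'h vec" and U U'
    assume init: "(U0, U1) \<in> states N" and ws: "weak_solution i g N A D U0 U1 U U'"
    note ws' = ws[unfolded weak_solution_iff[OF A(1) D(1)]]
    define c where "c r l = e_vec N n r $ l / euclid_norm (e_vec N n r)" for r l
    define w where "w r t = (\<Sum>l<N. c r l *\<^sub>R U t $ l)" for r t
    define w' where "w' r t = (\<Sum>l<N. c r l *\<^sub>R U' t $ l)" for r t
    have u: "group_comb N p n (\<lambda>r. w r t) = mat_act ?P (U t)" for t
      unfolding w_def c_def by (rule group_comb_coefficients)
    have u': "group_comb N p n (\<lambda>r. w' r t) = mat_act ?P (U' t)" for t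
      unfolding w'_def c_def by (rule group_comb_coefficients)
    have "C0V_C1H i (w r) (w' r)" for r
      unfolding w_def w'_def by (rule C0V_C1H_sum[OF i]) (use ws' in auto)
    moreover have "norm_VH (U t - mat_act ?P (U t), U' t - mat_act ?P (U' t))
        \<le> real N * real N * M * exp (- \<omega> * t) * norm_VH (mat_act_pair ?C (U0, U1))" if "0 \<le> t" for t
    proof -
      define B where "B = norm_VH (mat_act_pair ?C (U0, U1))"
      have Mt: "0 \<le> M * exp (- \<omega> * t)"
        using \<open>1 \<le> M\<close> by simp
      have "norm (U t $ k - mat_act ?P (U t) $ k, U' t $ k - mat_act ?P (U' t) $ k)
          \<le> M * exp (- \<omega> * t) * (N * B)" if "k < N" for k
      proof -
        obtain r where r: "r \<in> {1..p}" "k \<in> group_idx n r"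
          using ex_group_idx[OF g \<open>k < N\<close>] .
        \<comment> \<open>Synchronization compares the same pair \<open>k\<close>, \<open>l\<close>
          at time 0, so only initial differences inside group \<open>r\<close> enter, and these are
          bounded through \<open>C_mat\<close>.\<close>
        have "norm ((U t $ k, U' t $ k) - (U t $ l, U' t $ l)) \<le> M * exp (- \<omega> * t) * (N * B)"
          if l: "l \<in> group_idx n r" for l
        proof -
          have "norm ((U0 $ k, U1 $ k) - (U0 $ l, U1 $ l)) \<le> N * B"
            unfolding B_def using r l by (intro group_idx_norm_diff_le_C_mat[OF g]) auto
          then show ?thesis
            using sync[OF init ws r l \<open>0 \<le> t\<close>] mult_left_mono[OF _ Mt] by fastforce
        qed
        \<comment> \<open>The averaging bound is applied once, in the product space; the resulting
          sum of pairs is then split into its two components.\<close>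
        then have "norm ((U t $ k, U' t $ k) - (\<Sum>l<N. ?P $$ (k, l) *\<^sub>R (U t $ l, U' t $ l)))
            \<le> M * exp (- \<omega> * t) * (N * B)"
          using Mt norm_VH_nonneg[of "mat_act_pair ?C (U0, U1)"]
          by (intro norm_diff_group_projection_le[OF g r]) (auto simp: B_def)
        moreover have "(U t $ k, U' t $ k) - (\<Sum>l<N. ?P $$ (k, l) *\<^sub>R (U t $ l, U' t $ l)) =
            (U t $ k - mat_act ?P (U t) $ k, U' t $ k - mat_act ?P (U' t) $ k)"
          using \<open>k < N\<close> by (intro prod_eqI) (simp_all add: fst_sum snd_sum)
        ultimately show ?thesis by simp
      qed
      then have "norm_VH (U t - mat_act ?P (U t), U' t - mat_act ?P (U' t))
          \<le> N * (M * exp (- \<omega> * t) * (N * B))"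
        by (intro norm_VH_le) auto
      then show ?thesis
        by (simp add: B_def algebra_simps)
    qed
    \<comment> \<open>The definition reads initial data off the function at time 0, so
      \<open>U 0 = U0\<close> and \<open>U' 0 = U1\<close> from \<open>ws'\<close> match them with
      the projected data.\<close>
    moreover have "obeys_conservative_system i g N A (\<lambda>t. mat_act ?P (U t)) (\<lambda>t. mat_act ?P (U' t))"
      if "(\<lambda>x. A *\<^sub>v x) ` mat_kernel ?C \<subseteq> mat_kernel ?C" "mat_kernel ?C \<subseteq> mat_kernel D"
      unfolding obeys_conservative_system_def
      using weak_solution_mat_act[OF i A(1) D(1) group_projection_carrier
          group_projection_commute[OF g A that(1)] group_projection_mult_zero[OF g D that(2)] ws]
        energy_conserved_undamped[OF i assms(3)] ws'
      by auto
    ultimately show "\<exists>(w :: nat \<Rightarrow> real \<Rightarrow> 'v) (w' :: nat \<Rightarrow> real \<Rightarrow> 'h) u u'.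
        (\<forall>r\<in>{1..p}. C0V_C1H i (w r) (w' r)) \<and>
        u = (\<lambda>t. group_comb N p n (\<lambda>r. w r t)) \<and>
        u' = (\<lambda>t. group_comb N p n (\<lambda>r. w' r t)) \<and>
        (\<forall>t\<ge>0. norm_VH (U t - u t, U' t - u' t)
                 \<le> real N * real N * M * exp (- \<omega> * t) * norm_VH (mat_act_pair (C_mat p n) (U0, U1))) \<and>
        ((\<lambda>x. A *\<^sub>v x) ` mat_kernel (C_mat p n) \<subseteq> mat_kernel (C_mat p n) \<and>
         mat_kernel (C_mat p n) \<subseteq> mat_kernel D \<longrightarrow>
           obeys_conservative_system i g N A u u')"
      unfolding u[symmetric] u'[symmetric] by blast
  qed
qed

end
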